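(* Let $n,w,k$ be nonnegative integers with $0\le k\le n$. (1) If $k\le w\le n/2$, then $f(n,w,k)=\binom{n}{k}$, and an optimal code (a $w$-witness code of length $n$ with all codewords of weight $k$ and maximal size) is given by $S_k(\mathbf 0)$. (2) If $n-k\le w\le n/2$, then $f(n,w,n-k)=\binom{n}{k}$, and an optimal code (a $w$-witness code of length $n$ with all codewords of weight $n-k$ and maximal size) is given by $S_k(\mathbf 1)$.
   Context: Write $[n]=\{1,\dots,n\}$. A (binary) code of length $n$ is a set $C\subset\{0,1\}^n$. For $W\subset[n]$, let $\pi_W:\{0,1\}^n\to\{0,1\}^W$, $x\mapsto (x_i)_{i\in W}$. For $c\in C$, a set $W\subset[n]$ is a witness set (witness) for $c$ in $C$ if $\pi_W(c)\neq\pi_W(c')$ for every $c'\in C$ with $c'\neq c$. A code $C$ has the $w$-witness property (is a $w$-witness code) if each of its codewords has a witness set of size $w$. The weight of a word is its number of nonzero coordinates. $f(n,w,k)$ denotes the maximal size of a $w$-witness code of length $n$ all of whose codewords have weight $k$. $\mathbf 0$ and $\mathbf 1$ denote the all-zero and all-one words of length $n$, and $S_k(x)$ denotes the Hamming sphere of radius $k$ centered at $x$, i.e. the set of words of $\{0,1\}^n$ at Hamming distance exactly $k$ from $x$. *)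

theory Defs
  imports Complex_Main "HOL-Library.FuncSet"
begin

text \<open>
  Words of length \<open>n\<close> are functions on \<open>{1..n}\<close> with values in \<open>{0,1}\<close>, extensional outside
  \<open>{1..n}\<close>, so that equality of functions is equality of words.
\<close>

definition words :: "nat \<Rightarrow> (nat \<Rightarrow> nat) set" where
  "words n = {1..n} \<rightarrow>\<^sub>E {0, 1}"

definition proj :: "nat set \<Rightarrow> (nat \<Rightarrow> nat) \<Rightarrow> nat \<Rightarrow> nat" where
  "proj W x = restrict x W"

definition witness :: "nat \<Rightarrow> (nat \<Rightarrow> nat) set \<Rightarrow> (nat \<Rightarrow> nat) \<Rightarrow> nat set \<Rightarrow> bool" where
  "witness n C c W \<longleftrightarrow> W \<subseteq> {1..n} \<and> (\<forall>c'\<in>C. c' \<noteq> c \<longrightarrow> proj W c \<noteq> proj W c')"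

definition witness_code :: "nat \<Rightarrow> nat \<Rightarrow> (nat \<Rightarrow> nat) set \<Rightarrow> bool" where
  "witness_code n w C \<longleftrightarrow> C \<subseteq> words n \<and> (\<forall>c\<in>C. \<exists>W. card W = w \<and> witness n C c W)"

definition weight :: "nat \<Rightarrow> (nat \<Rightarrow> nat) \<Rightarrow> nat" where
  "weight n x = card {i \<in> {1..n}. x i \<noteq> 0}"

definition const_weight_witness_codes :: "nat \<Rightarrow> nat \<Rightarrow> nat \<Rightarrow> (nat \<Rightarrow> nat) set set" where
  "const_weight_witness_codes n w k = {C. witness_code n w C \<and> (\<forall>c\<in>C. weight n c = k)}"

text \<open>
  The maximum below is over a finite nonempty set: \<open>words n\<close> is finite, and the empty code
  always qualifies.
\<close>

definition max_code_size :: "nat \<Rightarrow> nat \<Rightarrow> nat \<Rightarrow> nat" where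
  "max_code_size n w k = Max (card ` const_weight_witness_codes n w k)"

definition optimal_code :: "nat \<Rightarrow> nat \<Rightarrow> nat \<Rightarrow> (nat \<Rightarrow> nat) set \<Rightarrow> bool" where
  "optimal_code n w k C \<longleftrightarrow>
     C \<in> const_weight_witness_codes n w k \<and>
     (\<forall>D \<in> const_weight_witness_codes n w k. card D \<le> card C)"

definition zero_word :: "nat \<Rightarrow> nat \<Rightarrow> nat" where
  "zero_word n = (\<lambda>i\<in>{1..n}. 0)"

definition one_word :: "nat \<Rightarrow> nat \<Rightarrow> nat" where
  "one_word n = (\<lambda>i\<in>{1..n}. 1)"

definition hamming_dist :: "nat \<Rightarrow> (nat \<Rightarrow> nat) \<Rightarrow> (nat \<Rightarrow> nat) \<Rightarrow> nat" where
  "hamming_dist n x y = card {i \<in> {1..n}. x i \<noteq> y i}"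

definition hamming_sphere :: "nat \<Rightarrow> nat \<Rightarrow> (nat \<Rightarrow> nat) \<Rightarrow> (nat \<Rightarrow> nat) set" where
  "hamming_sphere n k x = {y \<in> words n. hamming_dist n x y = k}"

end

theory Submission imports Defs begin

text \<open>
  A word is determined by its weight and its support: if two words of the same weight agree on a
  set \<open>W\<close> that contains the support of one of them, then one support lies inside the other, and
  equal (finite) sizes force the supports to coincide.  Hence, once \<open>w\<close> is at least the weight
  \<open>m\<close> and at most \<open>n\<close>, any \<open>w\<close>-set containing the support of a word separates it from every other
  word of weight \<open>m\<close>.  The code of all words of weight \<open>m\<close> therefore has the \<open>w\<close>-witness
  property, and it trivially contains every competitor (\<open>optimal_constant_weight\<close>); its size
  is the number of possible supports.

  Both spheres are such full codes: the sphere of radius \<open>k\<close> around \<open>zero_word n\<close> is the set of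
  words of weight \<open>k\<close>, and the one around \<open>one_word n\<close> is the set of words with exactly \<open>k\<close>
  zeros, that is, of weight \<open>n - k\<close>.  The second half is thus the first with \<open>n - k\<close> in place of \<open>k\<close>, up to the
  symmetry of binomial coefficients.
\<close>

definition support :: "nat \<Rightarrow> (nat \<Rightarrow> nat) \<Rightarrow> nat set" where
  "support n x = {i \<in> {1..n}. x i \<noteq> 0}"

definition constant_weight_words :: "nat \<Rightarrow> nat \<Rightarrow> (nat \<Rightarrow> nat) set" where
  "constant_weight_words n m = {x \<in> words n. weight n x = m}"

lemma support_subset: "support n x \<subseteq> {1..n}"
  by (auto simp: support_def)

lemma finite_support: "finite (support n x)"
  by (simp add: support_def)

lemma card_support: "card (support n x) = weight n x"
  by (simp add: support_def weight_def)

lemma finite_words: "finite (words n)"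
  unfolding words_def by (rule finite_PiE) auto

lemma words_binary: "x \<in> words n \<Longrightarrow> i \<in> {1..n} \<Longrightarrow> x i = 0 \<or> x i = 1"
  using PiE_mem[of x "{1..n}" "\<lambda>_. {0, 1}" i] unfolding words_def by blast

lemma words_eqI:
  assumes x: "x \<in> words n" and y: "y \<in> words n" and supp: "support n x = support n y"
  shows "x = y"
proof (rule PiE_ext[of x "{1..n}" "\<lambda>_. {0, 1}" y])
  show "x \<in> {1..n} \<rightarrow>\<^sub>E {0, 1}" "y \<in> {1..n} \<rightarrow>\<^sub>E {0, 1}"
    using x y by (simp_all add: words_def)
  fix i assume i: "i \<in> {1..n}"
  have "x i \<noteq> 0 \<longleftrightarrow> y i \<noteq> 0"
    using supp i by (auto simp: support_def set_eq_iff)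
  then show "x i = y i"
    using words_binary[OF x i] words_binary[OF y i] by metis
qed

lemma card_constant_weight_words: "card (constant_weight_words n m) = n choose m"
proof -
  have "bij_betw (support n) (constant_weight_words n m) {S. S \<subseteq> {1..n} \<and> card S = m}"
    unfolding bij_betw_def
  proof
    show "inj_on (support n) (constant_weight_words n m)"
      by (rule inj_onI) (auto simp: constant_weight_words_def intro: words_eqI)
    show "support n ` constant_weight_words n m = {S. S \<subseteq> {1..n} \<and> card S = m}"
    proof
      show "support n ` constant_weight_words n m \<subseteq> {S. S \<subseteq> {1..n} \<and> card S = m}"
        using support_subset by (auto simp: constant_weight_words_def card_support)
      show "{S. S \<subseteq> {1..n} \<and> card S = m} \<subseteq> support n ` constant_weight_words n m"
      proof
        fix S assume "S \<in> {S. S \<subseteq> {1..n} \<and> card S = m}"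
        then have S: "S \<subseteq> {1..n}" "card S = m" by auto
        define x :: "nat \<Rightarrow> nat" where "x = (\<lambda>i\<in>{1..n}. if i \<in> S then 1 else 0)"
        have "x \<in> words n" by (auto simp: x_def words_def)
        moreover have supp: "support n x = S" using S(1) by (auto simp: x_def support_def)
        moreover have "weight n x = m" using supp S(2) card_support[of n x] by simp
        ultimately show "S \<in> support n ` constant_weight_words n m"
          by (auto simp: constant_weight_words_def)
      qed
    qed
  qed
  then show ?thesis
    using n_subsets[of "{1..n}" m] by (simp add: bij_betw_same_card)
qed

text \<open>
  Agreement on \<open>W\<close> only says that the other support contains the support of \<open>c\<close>; the common weight
  turns this inclusion into an equality.
\<close>

lemma witness_if_contains_support:
  assumes c: "c \<in> constant_weight_words n m"
    and W: "support n c \<subseteq> W" "W \<subseteq> {1..n}"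
  shows "witness n (constant_weight_words n m) c W"
  unfolding witness_def
proof (intro conjI ballI impI W(2) notI)
  fix c' assume c': "c' \<in> constant_weight_words n m" and ne: "c' \<noteq> c"
    and eq: "proj W c = proj W c'"
  have "c i = c' i" if "i \<in> W" for i
    using fun_cong[OF eq, of i] that by (simp add: proj_def)
  then have "support n c \<subseteq> support n c'"
    using W(1) by (auto simp: support_def)
  moreover have "card (support n c) = card (support n c')"
    using c c' by (simp add: card_support constant_weight_words_def)
  ultimately have "support n c = support n c'"
    by (rule card_subset_eq[OF finite_support])
  moreover have "c \<in> words n" "c' \<in> words n"
    using c c' by (simp_all add: constant_weight_words_def)
  ultimately show False
    using words_eqI ne by metis
qed

lemma constant_weight_words_witness_code:
  assumes "m \<le> w" "w \<le> n"
  shows "witness_code n w (constant_weight_words n m)"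
  unfolding witness_code_def
proof (intro conjI ballI)
  show "constant_weight_words n m \<subseteq> words n"
    by (auto simp: constant_weight_words_def)
  fix c assume c: "c \<in> constant_weight_words n m"
  then have "card (support n c) \<le> w"
    using assms(1) by (simp add: card_support constant_weight_words_def)
  then obtain W where "support n c \<subseteq> W" "W \<subseteq> {1..n}" "card W = w"
    using exists_subset_between[of "support n c" w "{1..n}"] assms(2) support_subset[of n c]
    by auto
  then show "\<exists>W. card W = w \<and> witness n (constant_weight_words n m) c W"
    using witness_if_contains_support[OF c] by blast
qed

lemma max_code_size_if_optimal:
  assumes "optimal_code n w m C"
  shows "max_code_size n w m = card C"
  unfolding max_code_size_def
proof (rule Max_eqI)
  have "const_weight_witness_codes n w m \<subseteq> Pow (words n)"
    by (auto simp: const_weight_witness_codes_def witness_code_def)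
  then show "finite (card ` const_weight_witness_codes n w m)"
    by (meson finite_Pow_iff finite_imageI finite_subset finite_words)
qed (use assms in \<open>auto simp: optimal_code_def\<close>)

lemma optimal_constant_weight:
  assumes "m \<le> w" "w \<le> n"
  shows "optimal_code n w m (constant_weight_words n m)"
  unfolding optimal_code_def
proof (intro conjI ballI)
  show "constant_weight_words n m \<in> const_weight_witness_codes n w m"
    using constant_weight_words_witness_code[OF assms]
    by (simp add: const_weight_witness_codes_def) (simp add: constant_weight_words_def)
  fix D assume "D \<in> const_weight_witness_codes n w m"
  then have "D \<subseteq> constant_weight_words n m"
    by (auto simp: const_weight_witness_codes_def witness_code_def constant_weight_words_def)
  moreover have "finite (constant_weight_words n m)"
    using finite_words by (simp add: constant_weight_words_def)
  ultimately show "card D \<le> card (constant_weight_words n m)"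
    by (rule card_mono[rotated])
qed

lemma hamming_sphere_zero_word: "hamming_sphere n k (zero_word n) = constant_weight_words n k"
proof -
  have "{i \<in> {1..n}. zero_word n i \<noteq> y i} = {i \<in> {1..n}. y i \<noteq> 0}" for y
    by (auto simp: zero_word_def)
  then show ?thesis
    by (simp add: hamming_sphere_def constant_weight_words_def hamming_dist_def weight_def)
qed

lemma hamming_dist_one_word:
  assumes "y \<in> words n"
  shows "hamming_dist n (one_word n) y = n - weight n y"
proof -
  have "one_word n i \<noteq> y i \<longleftrightarrow> y i = 0" if "i \<in> {1..n}" for i
    using words_binary[OF assms that] that by (elim disjE) (simp_all add: one_word_def)
  then have "{i \<in> {1..n}. one_word n i \<noteq> y i} = {1..n} - support n y"
    by (simp add: support_def set_eq_iff cong: conj_cong)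
  then show ?thesis
    using card_Diff_subset[OF finite_support support_subset, of n y]
    by (simp add: hamming_dist_def card_support)
qed

lemma hamming_sphere_one_word:
  assumes "k \<le> n"
  shows "hamming_sphere n k (one_word n) = constant_weight_words n (n - k)"
proof -
  \<comment> \<open>The bound makes the truncated subtraction \<open>n - weight n y\<close> an involution.\<close>
  have "weight n y \<le> n" for y
    using card_mono[OF _ support_subset[of n y]] by (simp add: card_support)
  then have "n - weight n y = k \<longleftrightarrow> weight n y = n - k" for y
    using assms by (metis diff_diff_cancel)
  then have "hamming_dist n (one_word n) y = k \<longleftrightarrow> weight n y = n - k" if "y \<in> words n" for y
    unfolding hamming_dist_one_word[OF that] by blast
  then show ?thesis
    unfolding hamming_sphere_def constant_weight_words_def by blast
qed

theorem corollary3: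
  fixes n w k :: nat
  assumes "k \<le> n"
  shows "(k \<le> w \<and> real w \<le> real n / 2 \<longrightarrow>
            max_code_size n w k = n choose k \<and>
            optimal_code n w k (hamming_sphere n k (zero_word n))) \<and>
         (n - k \<le> w \<and> real w \<le> real n / 2 \<longrightarrow>
            max_code_size n w (n - k) = n choose k \<and>
            optimal_code n w (n - k) (hamming_sphere n k (one_word n)))"
proof -
  have full: "max_code_size n w m = n choose m \<and> optimal_code n w m (constant_weight_words n m)"
    if "m \<le> w" "real w \<le> real n / 2" for m
  proof -
    have "w \<le> n" using that(2) by linarith
    then have "optimal_code n w m (constant_weight_words n m)"
      by (rule optimal_constant_weight[OF that(1)])
    then show ?thesis
      by (simp add: max_code_size_if_optimal card_constant_weight_words)
  qed
  show ?thesis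
    unfolding hamming_sphere_zero_word hamming_sphere_one_word[OF assms]
    using full[of k] full[of "n - k"] unfolding binomial_symmetric[OF assms, symmetric]
    by blast
qed

end
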